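(* Let $T$ be an embedding tensor on a $3$-Lie algebra $(\mathfrak g,[\cdot,\cdot,\cdot]_{\mathfrak g})$ with respect to a representation $(V;\rho)$, and let $T_t=\sum_{i=0}^n\tau_it^i$ be an order $n$ deformation of $T$. Then $T_t$ is extendable if and only if the obstruction class $[\mathsf{Ob_T}]\in\mathcal H^3(T)$ is trivial.
   Context: All vector spaces are over an algebraically closed field $\mathbb K$ of characteristic $0$. A $3$-Lie algebra is a vector space $\mathfrak g$ with a skew-symmetric trilinear bracket $[\cdot,\cdot,\cdot]_{\mathfrak g}$ such that $[x_1,x_2,[x_3,x_4,x_5]_{\mathfrak g}]_{\mathfrak g}=[[x_1,x_2,x_3]_{\mathfrak g},x_4,x_5]_{\mathfrak g}+[x_3,[x_1,x_2,x_4]_{\mathfrak g},x_5]_{\mathfrak g}+[x_3,x_4,[x_1,x_2,x_5]_{\mathfrak g}]_{\mathfrak g}$ for all $x_i\in\mathfrak g$. A representation of $\mathfrak g$ on a vector space $V$ is a linear map $\rho:\wedge^2\mathfrak g\to\mathfrak{gl}(V)$ such that for all $x_i\in\mathfrak g$: $\rho(x_1,x_2)\rho(x_3,x_4)=\rho([x_1,x_2,x_3]_{\mathfrak g},x_4)+\rho(x_3,[x_1,x_2,x_4]_{\mathfrak g})+\rho(x_3,x_4)\rho(x_1,x_2)$ and $\rho(x_1,[x_2,x_3,x_4]_{\mathfrak g})=\rho(x_3,x_4)\rho(x_1,x_2)-\rho(x_2,x_4)\rho(x_1,x_3)+\rho(x_2,x_3)\rho(x_1,x_4)$. An embedding tensor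 on $\mathfrak g$ with respect to $(V;\rho)$ is a linear map $T:V\to\mathfrak g$ with $[Tu,Tv,Tw]_{\mathfrak g}=T(\rho(Tu,Tv)w)$ for all $u,v,w\in V$. Cohomology of $T$. Put $[u,v,w]_T=\rho(Tu,Tv)w$, $l_T(u,v)(x)=[Tu,Tv,x]_{\mathfrak g}$, $m_T(u,v)(x)=[Tu,x,Tv]_{\mathfrak g}-T(\rho(Tu,x)v)$, $r_T=-m_T$; for $U=u\otimes v$ write $[U,w]_T=[u,v,w]_T$, $l_T(U)=l_T(u,v)$. For $n\ge1$ let $\mathfrak C^n_{\mathsf{3Leib}}(V;\mathfrak g)=\mathrm{Hom}((\otimes^2V)^{\otimes(n-1)}\otimes V,\mathfrak g)$ and let $\partial_T:\mathfrak C^n_{\mathsf{3Leib}}(V;\mathfrak g)\to\mathfrak C^{n+1}_{\mathsf{3Leib}}(V;\mathfrak g)$ be, for $U_i=u_i\otimes v_i$, $w\in V$, $(\partial_T\theta)(U_1,\dots,U_n,w)=\sum_{1\le j<k\le n}(-1)^j\theta(U_1,\dots,\hat U_j,\dots,U_{k-1},[u_j,v_j,u_k]_T\otimes v_k,U_{k+1},\dots,U_n,w)$ $+\sum_{1\le j<k\le n}(-1)^j\theta(U_1,\dots,\hat U_j,\dots,U_{k-1},u_k\otimes[u_j,v_j,v_k]_T,U_{k+1},\dots,U_n,w)$ $+\sum_{j=1}^n\big((-1)^j\theta(U_1,\dots,\hat U_j,\dots,U_n,[U_j,w]_T)+(-1)^{j+1}l_T(U_j)\theta(U_1,\dots,\hat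 U_j,\dots,U_n,w)\big)$ $+(-1)^{n+1}\big(m_T(u_n,w)\theta(U_1,\dots,U_{n-1},v_n)+r_T(v_n,w)\theta(U_1,\dots,U_{n-1},u_n)\big)$. For $\mathfrak X\in\mathfrak g\wedge\mathfrak g$ let $\delta(\mathfrak X)v=T\rho(\mathfrak X)v-[\mathfrak X,Tv]_{\mathfrak g}$, where $[x\wedge y,z]_{\mathfrak g}=[x,y,z]_{\mathfrak g}$ (extended linearly). Set $\mathfrak C_T^1(V;\mathfrak g)=\mathfrak g\wedge\mathfrak g$, $\mathfrak C_T^k(V;\mathfrak g)=\mathfrak C^{k-1}_{\mathsf{3Leib}}(V;\mathfrak g)$ for $k\ge2$; $\mathrm d^{\mathsf T}$ equals $\delta$ on $\mathfrak C_T^1$ and $\partial_T$ on $\mathfrak C_T^k$, $k\ge2$. This is a cochain complex; $\mathcal Z^k(T)$ and $\mathcal B^k(T)$ are its $k$-cocycles and $k$-coboundaries and $\mathcal H^k(T)=\mathcal Z^k(T)/\mathcal B^k(T)$. Order $n$ deformations. An order $n$ deformation of $T$ is $T_t=\sum_{i=0}^n\tau_it^i$ with $\tau_0=T$, $\tau_i\in\mathrm{Hom}_{\mathbb K}(V,\mathfrak g)$, regarded as a $\mathbb K[[t]]/(t^{n+1})$-module map $V[[t]]/(t^{n+1})\to\mathfrak g[[t]]/(t^{n+1})$, with $[T_tu,T_tv,T_tw]_{\mathfrak g}=T_t(\rho(T_tu,T_tv)w)$ modulo $t^{n+1}$ for all $u,v,w\in V$ (bracket and $\rho$ extended multilinearly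 in $t$); equivalently $\sum_{i+j+k=s}\big([\tau_iu,\tau_jv,\tau_kw]_{\mathfrak g}-\tau_k(\rho(\tau_iu,\tau_jv)w)\big)=0$ for all $0\le s\le n$, $u,v,w\in V$. It is extendable if there is a linear map $\tau_{n+1}\in\mathrm{Hom}_{\mathbb K}(V,\mathfrak g)$ such that $T_t+\tau_{n+1}t^{n+1}$ is an order $n+1$ deformation of $T$. Define $\mathsf{Ob_T}\in\mathfrak C_T^3(V;\mathfrak g)$ by $\mathsf{Ob_T}(u,v,w)=\sum_{i+j+k=n+1,\ 0\le i,j,k\le n}\big([\tau_iu,\tau_jv,\tau_kw]_{\mathfrak g}-\tau_k(\rho(\tau_iu,\tau_jv)w)\big)$. It is a $3$-cocycle, and its class $[\mathsf{Ob_T}]\in\mathcal H^3(T)$ is called the obstruction class of $T_t$ being extendable. *)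

theory Defs
  imports "HOL-Library.Function_Algebras" "HOL-Computational_Algebra.Computational_Algebra"
begin

locale three_lie_algebra = vector_space scg
  for scg :: "'k::{alg_closed_field, field_char_0} \<Rightarrow> 'g::ab_group_add \<Rightarrow> 'g" +
  fixes br :: "'g \<Rightarrow> 'g \<Rightarrow> 'g \<Rightarrow> 'g"
  assumes br_linear1: "Vector_Spaces.linear scg scg (\<lambda>x. br x y z)"
    and br_linear2: "Vector_Spaces.linear scg scg (\<lambda>y. br x y z)"
    and br_linear3: "Vector_Spaces.linear scg scg (\<lambda>z. br x y z)"
    and br_skew12: "br x y z = - br y x z"
    and br_skew23: "br x y z = - br x z y"
    and fundamental_identity:
      "br x1 x2 (br x3 x4 x5) =
         br (br x1 x2 x3) x4 x5 + br x3 (br x1 x2 x4) x5 + br x3 x4 (br x1 x2 x5)"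

text \<open>A linear map from the exterior square of \<open>'g\<close> to \<open>gl(V)\<close> is given, by the universal
  property, as an alternating bilinear map: \<open>\<rho> x y\<close> is the image of \<open>x \<and> y\<close>.\<close>

locale three_lie_representation =
  three_lie_algebra scg br + V: vector_space scv
  for scg :: "'k::{alg_closed_field, field_char_0} \<Rightarrow> 'g::ab_group_add \<Rightarrow> 'g"
    and br :: "'g \<Rightarrow> 'g \<Rightarrow> 'g \<Rightarrow> 'g"
    and scv :: "'k \<Rightarrow> 'v::ab_group_add \<Rightarrow> 'v" +
  fixes \<rho> :: "'g \<Rightarrow> 'g \<Rightarrow> 'v \<Rightarrow> 'v"
  assumes rho_linear: "Vector_Spaces.linear scv scv (\<rho> x y)"
    and rho_linear1: "Vector_Spaces.linear scg scv (\<lambda>x. \<rho> x y v)"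
    and rho_linear2: "Vector_Spaces.linear scg scv (\<lambda>y. \<rho> x y v)"
    and rho_alternating: "\<rho> x x v = 0"
    and rho_rep1: "\<rho> x1 x2 (\<rho> x3 x4 v) =
      \<rho> (br x1 x2 x3) x4 v + \<rho> x3 (br x1 x2 x4) v + \<rho> x3 x4 (\<rho> x1 x2 v)"
    and rho_rep2: "\<rho> x1 (br x2 x3 x4) v =
      \<rho> x3 x4 (\<rho> x1 x2 v) - \<rho> x2 x4 (\<rho> x1 x3 v) + \<rho> x2 x3 (\<rho> x1 x4 v)"

definition omit :: "nat \<Rightarrow> 'a list \<Rightarrow> 'a list" where
  "omit j xs = take j xs @ drop (Suc j) xs"

locale embedding_tensor = three_lie_representation scg br scv \<rho>
  for scg :: "'k::{alg_closed_field, field_char_0} \<Rightarrow> 'g::ab_group_add \<Rightarrow> 'g"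
    and br :: "'g \<Rightarrow> 'g \<Rightarrow> 'g \<Rightarrow> 'g"
    and scv :: "'k \<Rightarrow> 'v::ab_group_add \<Rightarrow> 'v"
    and \<rho> :: "'g \<Rightarrow> 'g \<Rightarrow> 'v \<Rightarrow> 'v" +
  fixes T :: "'v \<Rightarrow> 'g"
  assumes T_linear: "Vector_Spaces.linear scv scg T"
    and T_embedding: "br (T u) (T v) (T w) = T (\<rho> (T u) (T v) w)"
begin

definition brT :: "'v \<Rightarrow> 'v \<Rightarrow> 'v \<Rightarrow> 'v" where
  "brT u v w = \<rho> (T u) (T v) w"

definition lT :: "'v \<Rightarrow> 'v \<Rightarrow> 'g \<Rightarrow> 'g" where
  "lT u v x = br (T u) (T v) x"

definition mT :: "'v \<Rightarrow> 'v \<Rightarrow> 'g \<Rightarrow> 'g" where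
  "mT u v x = br (T u) x (T v) - T (\<rho> (T u) x v)"

definition rT :: "'v \<Rightarrow> 'v \<Rightarrow> 'g \<Rightarrow> 'g" where
  "rT u v x = - mT u v x"

text \<open>For \<open>n \<ge> 1\<close>, a linear map from \<open>(V \<otimes> V)\<^sup>\<otimes>\<^sup>(\<^sup>n\<^sup>-\<^sup>1\<^sup>) \<otimes> V\<close> to \<open>\<gg>\<close> is encoded, by the universal property
  of the tensor product, as a map linear in each of its \<open>2n - 1\<close> arguments. The list entry
  \<open>(u, v)\<close> stands for \<open>u \<otimes> v\<close>. The value on lists of a wrong length is fixed to \<open>0\<close>, so that two
  cochains are equal iff they are equal as HOL functions.\<close>

definition leib_cochains :: "nat \<Rightarrow> (('v \<times> 'v) list \<Rightarrow> 'v \<Rightarrow> 'g) set" where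
  "leib_cochains n = {\<theta>.
     (\<forall>Us w. length Us \<noteq> n - 1 \<longrightarrow> \<theta> Us w = 0) \<and>
     (\<forall>Us. length Us = n - 1 \<longrightarrow> Vector_Spaces.linear scv scg (\<lambda>w. \<theta> Us w)) \<and>
     (\<forall>Us w k v. length Us = n - 1 \<and> k < n - 1 \<longrightarrow>
        Vector_Spaces.linear scv scg (\<lambda>u. \<theta> (Us[k := (u, v)]) w)) \<and>
     (\<forall>Us w k u. length Us = n - 1 \<and> k < n - 1 \<longrightarrow>
        Vector_Spaces.linear scv scg (\<lambda>v. \<theta> (Us[k := (u, v)]) w))}"

text \<open>List positions are counted from \<open>0\<close>, so position \<open>j\<close> is the index \<open>j + 1\<close> of the usual
  formula and \<open>(-1)\<^sup>j\<close> there becomes \<open>(-1) ^ Suc j\<close> here.\<close>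

definition leib_diff ::
  "nat \<Rightarrow> (('v \<times> 'v) list \<Rightarrow> 'v \<Rightarrow> 'g) \<Rightarrow> (('v \<times> 'v) list \<Rightarrow> 'v \<Rightarrow> 'g)" where
  "leib_diff n \<theta> Us w = (if length Us \<noteq> n then 0 else
     (\<Sum>k<n. \<Sum>j<k. case (Us ! j, Us ! k) of ((uj, vj), (uk, vk)) \<Rightarrow>
        scg ((-1) ^ Suc j) (\<theta> (omit j (Us[k := (brT uj vj uk, vk)])) w))
   + (\<Sum>k<n. \<Sum>j<k. case (Us ! j, Us ! k) of ((uj, vj), (uk, vk)) \<Rightarrow>
        scg ((-1) ^ Suc j) (\<theta> (omit j (Us[k := (uk, brT uj vj vk)])) w))
   + (\<Sum>j<n. case Us ! j of (uj, vj) \<Rightarrow>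
        scg ((-1) ^ Suc j) (\<theta> (omit j Us) (brT uj vj w))
      + scg ((-1) ^ (Suc j + 1)) (lT uj vj (\<theta> (omit j Us) w)))
   + (case last Us of (un, vn) \<Rightarrow>
        scg ((-1) ^ (n + 1))
          (mT un w (\<theta> (butlast Us) vn) + rT vn w (\<theta> (butlast Us) un))))"

text \<open>The value of \<open>\<delta>\<close> on the decomposable element \<open>x \<and> y\<close>, as an element of \<open>leib_cochains 1\<close>,
  that is, of \<open>Hom(V, \<gg>)\<close>.\<close>

definition delta :: "'g \<Rightarrow> 'g \<Rightarrow> (('v \<times> 'v) list \<Rightarrow> 'v \<Rightarrow> 'g)" where
  "delta x y Us v = (if Us = [] then T (\<rho> x y v) - br x y (T v) else 0)"

text \<open>The complex of \<open>T\<close> in degrees \<open>k \<ge> 2\<close>. The degree 1 term, the exterior square of \<open>\<gg>\<close>,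
  enters these degrees only through its image in degree 2, which is the span of the elements
  \<open>\<delta> (x \<and> y)\<close>. The sets below are meaningful for \<open>k \<ge> 2\<close> only.\<close>

definition cochains :: "nat \<Rightarrow> (('v \<times> 'v) list \<Rightarrow> 'v \<Rightarrow> 'g) set" where
  "cochains k = leib_cochains (k - 1)"

definition dT ::
  "nat \<Rightarrow> (('v \<times> 'v) list \<Rightarrow> 'v \<Rightarrow> 'g) \<Rightarrow> (('v \<times> 'v) list \<Rightarrow> 'v \<Rightarrow> 'g)" where
  "dT k = leib_diff (k - 1)"

definition cocycles :: "nat \<Rightarrow> (('v \<times> 'v) list \<Rightarrow> 'v \<Rightarrow> 'g) set" where
  "cocycles k = {\<theta> \<in> cochains k. dT k \<theta> = 0}"

definition coboundaries :: "nat \<Rightarrow> (('v \<times> 'v) list \<Rightarrow> 'v \<Rightarrow> 'g) set" where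
  "coboundaries k =
     (if k = 2 then module.span (\<lambda>c \<theta> Us w. scg c (\<theta> Us w)) (range (\<lambda>(x, y). delta x y))
      else dT (k - 1) ` cochains (k - 1))"

definition cohomologous ::
  "nat \<Rightarrow> ((('v \<times> 'v) list \<Rightarrow> 'v \<Rightarrow> 'g) \<times> (('v \<times> 'v) list \<Rightarrow> 'v \<Rightarrow> 'g)) set" where
  "cohomologous k = {(\<theta>, \<eta>). \<theta> \<in> cocycles k \<and> \<eta> \<in> cocycles k \<and> \<theta> - \<eta> \<in> coboundaries k}"

definition cohomology :: "nat \<Rightarrow> (('v \<times> 'v) list \<Rightarrow> 'v \<Rightarrow> 'g) set set" where
  "cohomology k = cocycles k // cohomologous k"

definition cohomology_class ::
  "nat \<Rightarrow> (('v \<times> 'v) list \<Rightarrow> 'v \<Rightarrow> 'g) \<Rightarrow> (('v \<times> 'v) list \<Rightarrow> 'v \<Rightarrow> 'g) set" where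
  "cohomology_class k \<theta> = cohomologous k `` {\<theta>}"

text \<open>The deformation \<open>\<tau>\<^sub>0 + \<tau>\<^sub>1 t + \<dots> + \<tau>\<^sub>n t\<^sup>n\<close> is given by its coefficients; \<open>\<tau> i\<close> is irrelevant
  for \<open>i > n\<close>. The last conjunct compares the coefficients of \<open>t\<^sup>s\<close> in the embedding tensor equation.\<close>

definition is_deformation :: "nat \<Rightarrow> (nat \<Rightarrow> 'v \<Rightarrow> 'g) \<Rightarrow> bool" where
  "is_deformation n \<tau> \<longleftrightarrow>
     \<tau> 0 = T \<and> (\<forall>i\<le>n. Vector_Spaces.linear scv scg (\<tau> i)) \<and>
     (\<forall>s\<le>n. \<forall>u v w. (\<Sum>(i, j, k) \<in> {(i, j, k). i + j + k = s}.
        br (\<tau> i u) (\<tau> j v) (\<tau> k w) - \<tau> k (\<rho> (\<tau> i u) (\<tau> j v) w)) = 0)"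

definition extendable :: "nat \<Rightarrow> (nat \<Rightarrow> 'v \<Rightarrow> 'g) \<Rightarrow> bool" where
  "extendable n \<tau> \<longleftrightarrow>
     (\<exists>\<sigma>. Vector_Spaces.linear scv scg \<sigma> \<and> is_deformation (n + 1) (\<tau>(n + 1 := \<sigma>)))"

definition Ob :: "nat \<Rightarrow> (nat \<Rightarrow> 'v \<Rightarrow> 'g) \<Rightarrow> (('v \<times> 'v) list \<Rightarrow> 'v \<Rightarrow> 'g)" where
  "Ob n \<tau> Us w = (case Us of
     [(u, v)] \<Rightarrow>
       (\<Sum>(i, j, k) \<in> {(i, j, k). i + j + k = n + 1 \<and> i \<le> n \<and> j \<le> n \<and> k \<le> n}.
          br (\<tau> i u) (\<tau> j v) (\<tau> k w) - \<tau> k (\<rho> (\<tau> i u) (\<tau> j v) w))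
   | _ \<Rightarrow> 0)"

definition obstruction_class :: "nat \<Rightarrow> (nat \<Rightarrow> 'v \<Rightarrow> 'g) \<Rightarrow> (('v \<times> 'v) list \<Rightarrow> 'v \<Rightarrow> 'g) set" where
  "obstruction_class n \<tau> = cohomology_class 3 (Ob n \<tau>)"

end

end

theory Submission
  imports Defs
begin

text \<open>
  Replace \<open>T\<^sub>t\<close> by \<open>T\<^sub>t + \<sigma> t\<^sup>n\<^sup>+\<^sup>1\<close>. The coefficients of \<open>t\<^sup>0, \<dots>, t\<^sup>n\<close> in the embedding tensor
  equation do not see \<open>\<sigma>\<close>. The coefficient of \<open>t\<^sup>n\<^sup>+\<^sup>1\<close> is a sum over triples \<open>i + j + k = n + 1\<close>:
  the triples with all indices at most \<open>n\<close> make up the obstruction cochain, and the three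
  triples with an index \<open>n + 1\<close> have their other two indices equal to \<open>0\<close>, so they give the
  derivative at \<open>T\<close> of the defect \<open>S \<mapsto> [Su, Sv, Sw] - S (\<rho>(Su, Sv) w)\<close> in the direction \<open>\<sigma>\<close>
  (\<open>defect_top_coefficient\<close>). That derivative is exactly the differential of \<open>\<sigma>\<close>
  (\<open>leib_diff_1\<close>). Hence extending by \<open>\<sigma>\<close> means \<open>Ob + \<partial>\<sigma> = 0\<close>, and since \<open>\<sigma>\<close> may be replaced by
  \<open>- \<sigma>\<close>, an extension exists iff the obstruction is a coboundary.

  It remains to pass from coboundaries to classes, which are sets of cocycles, empty for a cochain
  that is not closed. That \<open>\<theta>\<close> has the class of \<open>0\<close> iff it is a coboundary
  (\<open>cohomology_class_eq_0_iff\<close>) therefore rests on \<open>\<partial> \<circ> \<partial> = 0\<close> in the lowest degree, which makes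
  coboundaries closed. This equation reflects that \<open>V\<close> is a 3-Leibniz algebra under \<open>[u, v, w]\<^sub>T\<close> and
  that \<open>\<gg>\<close> is a representation of it through \<open>l\<^sub>T\<close>, \<open>m\<^sub>T\<close> and \<open>r\<^sub>T\<close>; the corresponding identities
  (\<open>brT_leibniz\<close>, \<open>lT_lT\<close>, \<open>lT_mT\<close>, \<open>mT_brT\<close>) cancel the terms of \<open>\<partial>(\<partial>\<sigma>)\<close>.
\<close>

context embedding_tensor
begin

section \<open>Multilinearity as rewrite rules\<close>

lemma linear_rules:
  assumes "Vector_Spaces.linear s1 s2 f"
  shows "f (x + y) = f x + f y" "f (x - y) = f x - f y" "f (- x) = - f x" "f 0 = 0"
    "f (s1 c x) = s2 c (f x)"
proof -
  interpret L: Vector_Spaces.linear s1 s2 f by (rule assms)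
  show "f (x + y) = f x + f y" "f (x - y) = f x - f y" "f (- x) = - f x" "f 0 = 0"
    "f (s1 c x) = s2 c (f x)"
    by (simp_all add: L.add L.diff L.neg L.zero L.scale)
qed

lemmas multilinear =
  linear_rules[OF br_linear1] linear_rules[OF br_linear2] linear_rules[OF br_linear3]
  linear_rules[OF rho_linear1] linear_rules[OF rho_linear2] linear_rules[OF rho_linear]
  linear_rules[OF T_linear]

lemma linear_V_gI:
  assumes "\<And>x y. f (x + y) = f x + f y" and "\<And>c x. f (scv c x) = scg c (f x)"
  shows "Vector_Spaces.linear scv scg f"
  using assms vector_space_axioms V.vector_space_axioms unfolding Vector_Spaces.linear_iff by blast

lemma linear_V_g_zero: "Vector_Spaces.linear scv scg (\<lambda>_. 0)"
  by (rule linear_V_gI) simp_all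

lemma rho_skew: "\<rho> x y v = - \<rho> y x v"
proof -
  have "\<rho> (x + y) (x + y) v = 0" by (rule rho_alternating)
  then have "\<rho> x y v + \<rho> y x v = 0"
    unfolding multilinear by (simp add: rho_alternating add.commute)
  then show ?thesis by (simp only: eq_neg_iff_add_eq_0)
qed

section \<open>The action of the 3-Leibniz algebra \<open>V\<close> on \<open>\<gg>\<close>\<close>

lemma T_brT: "T (brT u v w) = br (T u) (T v) (T w)"
  by (simp add: brT_def T_embedding)

text \<open>With \<open>[Tu, Tv, Tw] = T [u, v, w]\<^sub>T\<close> substituted, the first axiom of a representation says that
  the left multiplications \<open>[u, v, -]\<^sub>T\<close> are derivations.\<close>

lemma brT_leibniz:
  "brT u1 v1 (brT u2 v2 w) =
     brT (brT u1 v1 u2) v2 w + brT u2 (brT u1 v1 v2) w + brT u2 v2 (brT u1 v1 w)"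
  unfolding brT_def T_embedding[symmetric] by (rule rho_rep1)

lemma lT_lT:
  "lT u1 v1 (lT u2 v2 x) =
     lT (brT u1 v1 u2) v2 x + lT u2 (brT u1 v1 v2) x + lT u2 v2 (lT u1 v1 x)"
  unfolding lT_def T_brT by (rule fundamental_identity)

text \<open>Both terms of \<open>m\<^sub>T\<close> are compatible with the action of \<open>(Tu\<^sub>1, Tv\<^sub>1)\<close>: the bracket by the
  fundamental identity, and the term \<open>T(\<rho>(Tu\<^sub>2, x) w)\<close> because \<open>[Tu\<^sub>1, Tv\<^sub>1, -] \<circ> T =
  T \<circ> \<rho>(Tu\<^sub>1, Tv\<^sub>1)\<close> and \<open>\<rho>\<close> satisfies the analogous identity.\<close>

lemma lT_mT:
  "lT u1 v1 (mT u2 w x) =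
     mT (brT u1 v1 u2) w x + mT u2 (brT u1 v1 w) x + mT u2 w (lT u1 v1 x)"
proof -
  have "br (T u1) (T v1) (T (\<rho> (T u2) x w)) =
      T (\<rho> (br (T u1) (T v1) (T u2)) x w) + T (\<rho> (T u2) (br (T u1) (T v1) x) w)
      + T (\<rho> (T u2) x (brT u1 v1 w))"
    unfolding T_embedding[of u1 v1] rho_rep1[of "T u1" "T v1" "T u2"] multilinear brT_def ..
  then show ?thesis
    unfolding lT_def mT_def T_brT multilinear fundamental_identity[of "T u1" "T v1" "T u2"]
    by (simp add: algebra_simps)
qed

text \<open>This is the difference of the fundamental identity for \<open>[Tu\<^sub>1, x, -]\<close> and the image under
  \<open>T\<close> of the first representation axiom for \<open>\<rho>(Tu\<^sub>1, x)\<close>. The inner \<open>m\<^sub>T\<close> on the right bring in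
  values \<open>T(\<rho>(Tu\<^sub>1, x) y)\<close> as well, for \<open>y\<close> one of \<open>u\<^sub>2\<close>, \<open>v\<^sub>2\<close>, \<open>w\<close>. For \<open>y = u\<^sub>2\<close> and \<open>y = v\<^sub>2\<close> such
  a value occurs once in a bracket and once under \<open>\<rho>\<close>, which cancel because \<open>T\<close> is an embedding
  tensor; for \<open>y = w\<close> the bracket is the term \<open>T(\<rho>(Tu\<^sub>2, Tv\<^sub>2) \<rho>(Tu\<^sub>1, x) w)\<close> of the axiom.\<close>

lemma mT_brT:
  "mT u1 (brT u2 v2 w) x = mT u2 w (mT u1 v2 x) + rT v2 w (mT u1 u2 x) + lT u2 v2 (mT u1 w x)"
proof -
  let ?p = "\<rho> (T u1) x u2" and ?q = "\<rho> (T u1) x v2"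
  have p: "br (T ?p) (T v2) (T w) = T (\<rho> (T ?p) (T v2) w)"
    and q: "br (T u2) (T ?q) (T w) = T (\<rho> (T u2) (T ?q) w)"
    and r: "br (T u2) (T v2) (T (\<rho> (T u1) x w)) = T (\<rho> (T u2) (T v2) (\<rho> (T u1) x w))"
    by (rule T_embedding)+
  have rT: "rT v2 w y = br y (T v2) (T w) - T (\<rho> y (T v2) w)" for y
    using br_skew12[of "T v2" y "T w"] rho_skew[of "T v2" y w]
    by (simp add: rT_def mT_def multilinear)
  have rep: "\<rho> (T u1) x (\<rho> (T u2) (T v2) w) =
      \<rho> (br (T u1) x (T u2)) (T v2) w + \<rho> (T u2) (br (T u1) x (T v2)) w
      + \<rho> (T u2) (T v2) (\<rho> (T u1) x w)"
    by (rule rho_rep1)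
  show ?thesis
    unfolding rT unfolding mT_def lT_def T_brT
    unfolding brT_def multilinear p q r
    unfolding rep fundamental_identity[of "T u1" x "T u2" "T v2" "T w"] multilinear
    by (simp add: T_embedding algebra_simps)
qed

lemma action_linear:
  "lT u v (x + y) = lT u v x + lT u v y" "lT u v (x - y) = lT u v x - lT u v y"
  "lT u v (- x) = - lT u v x" "lT u v 0 = 0"
  "mT u v (x + y) = mT u v x + mT u v y" "mT u v (x - y) = mT u v x - mT u v y"
  "mT u v (- x) = - mT u v x" "mT u v 0 = 0"
  "rT u v (x - y) = rT u v x - rT u v y" "rT u v 0 = 0"
  by (simp_all add: lT_def mT_def rT_def multilinear)

section \<open>The two lowest differentials\<close>

text \<open>The derivative at \<open>T\<close>, in the direction \<open>\<sigma>\<close>, of the defect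
  \<open>S \<mapsto> [Su, Sv, Sw] - S (\<rho>(Su, Sv) w)\<close> whose zeros are the embedding tensors.\<close>

definition lin_defect :: "('v \<Rightarrow> 'g) \<Rightarrow> 'v \<Rightarrow> 'v \<Rightarrow> 'v \<Rightarrow> 'g" where
  "lin_defect \<sigma> u v w = lT u v (\<sigma> w) + mT u w (\<sigma> v) + rT v w (\<sigma> u) - \<sigma> (brT u v w)"

lemma leib_diff_1: "leib_diff 1 \<theta> [(u, v)] w = lin_defect (\<theta> []) u v w"
  by (simp add: leib_diff_def omit_def lin_defect_def)

lemma leib_diff_2:
  "leib_diff 2 \<theta> [(u1, v1), (u2, v2)] w =
     - \<theta> [(brT u1 v1 u2, v2)] w - \<theta> [(u2, brT u1 v1 v2)] w
     - \<theta> [(u2, v2)] (brT u1 v1 w) + lT u1 v1 (\<theta> [(u2, v2)] w)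
     + \<theta> [(u1, v1)] (brT u2 v2 w) - lT u2 v2 (\<theta> [(u1, v1)] w)
     - mT u2 w (\<theta> [(u1, v1)] v2) - rT v2 w (\<theta> [(u1, v1)] u2)"
  by (simp add: leib_diff_def omit_def eval_nat_numeral)

text \<open>Write \<open>\<sigma> = \<theta> []\<close> and collect the terms by the value of \<open>\<sigma>\<close> they contain. Those at \<open>\<sigma> w\<close> cancel
  by \<open>lT_lT\<close>, those at \<open>\<sigma> u\<^sub>1\<close> and \<open>\<sigma> v\<^sub>1\<close> by \<open>mT_brT\<close>, those at \<open>\<sigma> u\<^sub>2\<close> and \<open>\<sigma> v\<^sub>2\<close> by \<open>lT_mT\<close>, those at
  iterated brackets by \<open>brT_leibniz\<close>, and those at single brackets in pairs.\<close>

lemma leib_diff_2_leib_diff_1: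
  assumes "Vector_Spaces.linear scv scg (\<theta> [])"
  shows "leib_diff 2 (leib_diff 1 \<theta>) = 0"
proof (intro ext)
  fix Us :: "('v \<times> 'v) list" and w :: 'v
  note lin = linear_rules[OF assms]
  show "leib_diff 2 (leib_diff 1 \<theta>) Us w = 0 Us w"
  proof (cases "length Us = 2")
    case True
    then obtain u1 v1 u2 v2 where Us: "Us = [(u1, v1), (u2, v2)]"
      by (auto simp: length_Suc_conv eval_nat_numeral)
    let ?s = "\<theta> []"
    have rr: "rT u w x = - mT u w x" for u w x by (simp add: rT_def)
    have m: "mT u (brT u2 v2 w) x =
        mT u2 w (mT u v2 x) - mT v2 w (mT u u2 x) + lT u2 v2 (mT u w x)" for u x
      using mT_brT[of u u2 v2 w x] by (simp add: rr)
    show ?thesis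
      unfolding Us leib_diff_2 leib_diff_1 lin_defect_def rr action_linear lin
      unfolding lT_lT[of u1 v1 u2 v2 "?s w"] lT_mT[of u1 v1 u2] lT_mT[of u1 v1 v2]
        brT_leibniz[of u1 v1 u2 v2 w] m lin action_linear
      by (simp only: algebra_simps) simp
  qed (simp add: leib_diff_def)
qed

section \<open>Coboundaries and the trivial class in degree 3\<close>

lemma degree_3_eqI:
  assumes "\<And>Us w. length Us \<noteq> 1 \<Longrightarrow> \<theta> Us w = 0" and "\<And>Us w. length Us \<noteq> 1 \<Longrightarrow> \<eta> Us w = 0"
    and "\<And>u v w. \<theta> [(u, v)] w = \<eta> [(u, v)] w"
  shows "\<theta> = \<eta>"
proof (intro ext)
  fix Us w
  show "\<theta> Us w = \<eta> Us w"
  proof (cases "length Us = 1")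
    case True
    then obtain u v where "Us = [(u, v)]" by (auto simp: length_Suc_conv)
    then show ?thesis by (simp only: assms(3))
  qed (simp only: assms(1,2) not_False_eq_True)
qed

lemma leib_diff_eq_0: "length Us \<noteq> n \<Longrightarrow> leib_diff n \<theta> Us w = 0"
  by (simp add: leib_diff_def)

lemma lin_defect_diff:
  "lin_defect (\<lambda>w. \<sigma> w - \<sigma>' w) u v w = lin_defect \<sigma> u v w - lin_defect \<sigma>' u v w"
  by (simp add: lin_defect_def action_linear)

lemma lin_defect_uminus: "lin_defect (\<lambda>w. - \<sigma> w) u v w = - lin_defect \<sigma> u v w"
  using lin_defect_diff[of "\<lambda>_. 0" \<sigma> u v w]
  by (simp add: lin_defect_def action_linear)

definition one_cochain :: "('v \<Rightarrow> 'g) \<Rightarrow> (('v \<times> 'v) list \<Rightarrow> 'v \<Rightarrow> 'g)" where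
  "one_cochain \<sigma> Us w = (if Us = [] then \<sigma> w else 0)"

lemma one_cochain_Nil [simp]: "one_cochain \<sigma> [] = \<sigma>"
  by (simp add: one_cochain_def fun_eq_iff)

lemma leib_cochains_1: "leib_cochains 1 = one_cochain ` {\<sigma>. Vector_Spaces.linear scv scg \<sigma>}"
proof (intro equalityI subsetI)
  fix \<theta> assume "\<theta> \<in> leib_cochains 1"
  then have "Vector_Spaces.linear scv scg (\<theta> [])" "\<And>Us w. Us \<noteq> [] \<Longrightarrow> \<theta> Us w = 0"
    by (auto simp: leib_cochains_def)
  moreover from this(2) have "\<theta> = one_cochain (\<theta> [])"
    by (auto simp: one_cochain_def fun_eq_iff)
  ultimately show "\<theta> \<in> one_cochain ` {\<sigma>. Vector_Spaces.linear scv scg \<sigma>}" by blast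
next
  fix \<theta> assume "\<theta> \<in> one_cochain ` {\<sigma>. Vector_Spaces.linear scv scg \<sigma>}"
  then show "\<theta> \<in> leib_cochains 1"
    by (auto simp: leib_cochains_def one_cochain_def)
qed

lemma coboundaries_3_iff:
  "\<eta> \<in> coboundaries 3 \<longleftrightarrow>
     (\<exists>\<sigma>. Vector_Spaces.linear scv scg \<sigma> \<and> \<eta> = leib_diff 1 (one_cochain \<sigma>))"
  using leib_cochains_1 by (auto simp: coboundaries_def dT_def cochains_def)

lemma leib_diff_1_in_cochains:
  assumes "Vector_Spaces.linear scv scg \<sigma>"
  shows "leib_diff 1 (one_cochain \<sigma>) \<in> cochains 3"
proof -
  note lin = linear_rules[OF assms]
  note expand = lin_defect_def lT_def mT_def rT_def brT_def multilinear lin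
  have w: "Vector_Spaces.linear scv scg (\<lambda>w. lin_defect \<sigma> u v w)" for u v
    unfolding expand by (rule linear_V_gI) (simp_all add: multilinear lin algebra_simps)
  have u: "Vector_Spaces.linear scv scg (\<lambda>u. lin_defect \<sigma> u v w)" for v w
    unfolding expand by (rule linear_V_gI) (simp_all add: multilinear lin algebra_simps)
  have v: "Vector_Spaces.linear scv scg (\<lambda>v. lin_defect \<sigma> u v w)" for u w
    unfolding expand by (rule linear_V_gI) (simp_all add: multilinear lin algebra_simps)
  have single: "\<exists>u v. Us = [(u, v)]" if "length Us = Suc 0" for Us :: "('v \<times> 'v) list"
    using that by (auto simp: length_Suc_conv)
  have leib: "leib_diff (Suc 0) (one_cochain \<sigma>) [(u, v)] = lin_defect \<sigma> u v" for u v
    using leib_diff_1[of "one_cochain \<sigma>"] by (simp add: fun_eq_iff)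
  show ?thesis
    unfolding cochains_def leib_cochains_def
    by (auto dest!: single simp: leib u v w) (auto simp: leib_diff_def)
qed

lemma coboundaries_subset_cocycles: "coboundaries 3 \<subseteq> cocycles 3"
  using leib_diff_1_in_cochains leib_diff_2_leib_diff_1
  by (auto simp: coboundaries_3_iff cocycles_def dT_def)

lemma coboundaries_diff:
  assumes "\<theta> \<in> coboundaries 3" and "\<eta> \<in> coboundaries 3"
  shows "\<theta> - \<eta> \<in> coboundaries 3"
proof -
  obtain \<sigma> \<sigma>' where lin: "Vector_Spaces.linear scv scg \<sigma>" "Vector_Spaces.linear scv scg \<sigma>'"
    and eq: "\<theta> = leib_diff 1 (one_cochain \<sigma>)" "\<eta> = leib_diff 1 (one_cochain \<sigma>')"
    using assms by (auto simp: coboundaries_3_iff)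
  let ?\<sigma> = "\<lambda>w. \<sigma> w - \<sigma>' w"
  have "\<theta> - \<eta> = leib_diff 1 (one_cochain ?\<sigma>)"
    unfolding eq
    by (rule degree_3_eqI)
      (simp_all only: fun_diff_def leib_diff_eq_0 leib_diff_1 one_cochain_Nil lin_defect_diff
        diff_zero not_False_eq_True)
  moreover have "Vector_Spaces.linear scv scg ?\<sigma>"
    by (rule linear_V_gI)
      (simp_all add: linear_rules[OF lin(1)] linear_rules[OF lin(2)] scale_right_diff_distrib)
  ultimately show ?thesis by (auto simp: coboundaries_3_iff)
qed

lemma zero_in_coboundaries: "0 \<in> coboundaries 3"
proof -
  have "leib_diff 1 (one_cochain (\<lambda>_. 0)) \<in> coboundaries 3"
    using linear_V_g_zero by (auto simp: coboundaries_3_iff)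
  from coboundaries_diff[OF this this] show ?thesis by simp
qed

text \<open>The class of \<open>\<theta>\<close> is empty unless \<open>\<theta>\<close> is a cocycle, whereas the class of \<open>0\<close> contains \<open>0\<close>.
  So equal classes put \<open>0\<close> into the class of \<open>\<theta>\<close>. Conversely, coboundaries are cocycles and form
  an additive group, so shifting by \<open>\<theta>\<close> does not affect being a coboundary.\<close>

lemma cohomology_class_eq_0_iff:
  "cohomology_class 3 \<theta> = cohomology_class 3 0 \<longleftrightarrow> \<theta> \<in> coboundaries 3"
proof
  assume eq: "cohomology_class 3 \<theta> = cohomology_class 3 0"
  have "0 \<in> cohomology_class 3 0"
    using zero_in_coboundaries coboundaries_subset_cocycles
    by (auto simp: cohomology_class_def cohomologous_def)
  then have "0 \<in> cohomology_class 3 \<theta>" by (simp only: eq)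
  then show "\<theta> \<in> coboundaries 3"
    by (simp add: cohomology_class_def cohomologous_def)
next
  assume \<theta>: "\<theta> \<in> coboundaries 3"
  have "\<theta> - \<eta> \<in> coboundaries 3 \<longleftrightarrow> 0 - \<eta> \<in> coboundaries 3" for \<eta>
  proof
    assume "\<theta> - \<eta> \<in> coboundaries 3"
    from coboundaries_diff[OF this \<theta>] show "0 - \<eta> \<in> coboundaries 3" by simp
  next
    assume "0 - \<eta> \<in> coboundaries 3"
    then have "0 - (0 - \<eta>) \<in> coboundaries 3"
      by (rule coboundaries_diff[OF zero_in_coboundaries])
    then show "\<theta> - \<eta> \<in> coboundaries 3" using coboundaries_diff[OF \<theta>] by simp
  qed
  moreover have "\<theta> \<in> cocycles 3" "0 \<in> cocycles 3"
    using \<theta> zero_in_coboundaries coboundaries_subset_cocycles by auto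
  ultimately show "cohomology_class 3 \<theta> = cohomology_class 3 0"
    by (auto simp: cohomology_class_def cohomologous_def)
qed

section \<open>The first new coefficient of an extension\<close>

definition defect_term :: "(nat \<Rightarrow> 'v \<Rightarrow> 'g) \<Rightarrow> 'v \<Rightarrow> 'v \<Rightarrow> 'v \<Rightarrow> nat \<times> nat \<times> nat \<Rightarrow> 'g" where
  "defect_term \<tau> u v w = (\<lambda>(i, j, k).
     br (\<tau> i u) (\<tau> j v) (\<tau> k w) - \<tau> k (\<rho> (\<tau> i u) (\<tau> j v) w))"

lemma is_deformation_iff:
  "is_deformation n \<tau> \<longleftrightarrow> \<tau> 0 = T \<and> (\<forall>i\<le>n. Vector_Spaces.linear scv scg (\<tau> i)) \<and>
    (\<forall>s\<le>n. \<forall>u v w. (\<Sum>p\<in>{(i, j, k). i + j + k = s}. defect_term \<tau> u v w p) = 0)"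
  by (simp add: is_deformation_def defect_term_def)

text \<open>An index \<open>n + 1\<close> in a triple of sum \<open>n + 1\<close> forces the other two to be \<open>0\<close>, where \<open>\<tau>\<close> is
  \<open>T\<close>; so \<open>\<sigma>\<close> enters linearly, through the derivative of the defect at \<open>T\<close>.\<close>

lemma defect_top_coefficient:
  assumes "\<tau> 0 = T"
  shows "(\<Sum>p\<in>{(i, j, k). i + j + k = n + 1}. defect_term (\<tau>(n + 1 := \<sigma>)) u v w p) =
    Ob n \<tau> [(u, v)] w + lin_defect \<sigma> u v w"
proof -
  let ?\<tau> = "\<tau>(n + 1 := \<sigma>)"
  let ?low = "{(i, j, k). i + j + k = n + 1 \<and> i \<le> n \<and> j \<le> n \<and> k \<le> n}"
  let ?top = "{(n + 1, 0, 0), (0, n + 1, 0), (0, 0, n + 1)}"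
  have fin: "finite ?low"
    by (rule finite_subset[of _ "{..n} \<times> {..n} \<times> {..n}"]) auto
  have split: "{(i, j, k). i + j + k = n + 1} = ?low \<union> ?top" by auto
  have "(\<Sum>p\<in>{(i, j, k). i + j + k = n + 1}. defect_term ?\<tau> u v w p) =
      (\<Sum>p\<in>?low. defect_term ?\<tau> u v w p) + (\<Sum>p\<in>?top. defect_term ?\<tau> u v w p)"
    unfolding split by (rule sum.union_disjoint) (use fin in auto)
  also have "(\<Sum>p\<in>?low. defect_term ?\<tau> u v w p) = Ob n \<tau> [(u, v)] w"
    by (auto simp: Ob_def defect_term_def intro!: sum.cong)
  also have "(\<Sum>p\<in>?top. defect_term ?\<tau> u v w p) =
      br (\<sigma> u) (T v) (T w) - T (\<rho> (\<sigma> u) (T v) w)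
      + (br (T u) (\<sigma> v) (T w) - T (\<rho> (T u) (\<sigma> v) w))
      + (br (T u) (T v) (\<sigma> w) - \<sigma> (\<rho> (T u) (T v) w))"
    by (simp add: defect_term_def assms)
  also have "\<dots> = lin_defect \<sigma> u v w"
    using br_skew12[of "T v" "\<sigma> u" "T w"] rho_skew[of "T v" "\<sigma> u" w]
    by (simp add: lin_defect_def lT_def mT_def rT_def brT_def multilinear)
  finally show ?thesis .
qed

lemma extendable_iff:
  assumes "is_deformation n \<tau>"
  shows "extendable n \<tau> \<longleftrightarrow> (\<exists>\<sigma>. Vector_Spaces.linear scv scg \<sigma> \<and>
    (\<forall>u v w. Ob n \<tau> [(u, v)] w + lin_defect \<sigma> u v w = 0))"
proof -
  have T: "\<tau> 0 = T" and lin: "\<And>i. i \<le> n \<Longrightarrow> Vector_Spaces.linear scv scg (\<tau> i)"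
    and low: "\<And>s u v w. s \<le> n \<Longrightarrow> (\<Sum>p\<in>{(i, j, k). i + j + k = s}. defect_term \<tau> u v w p) = 0"
    using assms by (auto simp: is_deformation_iff)
  have "is_deformation (n + 1) (\<tau>(n + 1 := \<sigma>)) \<longleftrightarrow>
      (\<forall>u v w. Ob n \<tau> [(u, v)] w + lin_defect \<sigma> u v w = 0)"
    if \<sigma>: "Vector_Spaces.linear scv scg \<sigma>" for \<sigma>
  proof -
    have "(\<Sum>p\<in>{(i, j, k). i + j + k = s}. defect_term (\<tau>(n + 1 := \<sigma>)) u v w p) = 0"
      if "s \<le> n" for s u v w
    proof -
      \<comment> \<open>no index of a triple of sum \<open>s \<le> n\<close> reaches \<open>n + 1\<close>\<close>
      have "(\<Sum>p\<in>{(i, j, k). i + j + k = s}. defect_term (\<tau>(n + 1 := \<sigma>)) u v w p) =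
          (\<Sum>p\<in>{(i, j, k). i + j + k = s}. defect_term \<tau> u v w p)"
        using that by (intro sum.cong) (auto simp: defect_term_def)
      then show ?thesis using low[OF that] by simp
    qed
    moreover have "Vector_Spaces.linear scv scg ((\<tau>(n + 1 := \<sigma>)) i)" if "i \<le> n + 1" for i
      using that lin[of i] \<sigma> by simp
    moreover have "(\<forall>s\<le>n + 1. P s) \<longleftrightarrow> (\<forall>s\<le>n. P s) \<and> P (n + 1)" for P
      by (auto simp: le_Suc_eq)
    ultimately show ?thesis
      unfolding is_deformation_iff using T defect_top_coefficient[of \<tau> n \<sigma>, OF T] by simp
  qed
  then show ?thesis unfolding extendable_def by blast
qed

text \<open>If \<open>Ob = \<partial>\<sigma>\<close>, then \<open>- \<sigma>\<close> solves \<open>Ob + \<partial>(- \<sigma>) = 0\<close>, and conversely.\<close>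

lemma Ob_coboundary_iff:
  "Ob n \<tau> \<in> coboundaries 3 \<longleftrightarrow> (\<exists>\<sigma>. Vector_Spaces.linear scv scg \<sigma> \<and>
    (\<forall>u v w. Ob n \<tau> [(u, v)] w + lin_defect \<sigma> u v w = 0))"
proof -
  have ext: "Ob n \<tau> = leib_diff 1 (one_cochain \<sigma>) \<longleftrightarrow>
      (\<forall>u v w. Ob n \<tau> [(u, v)] w = lin_defect \<sigma> u v w)" for \<sigma>
  proof
    assume *: "\<forall>u v w. Ob n \<tau> [(u, v)] w = lin_defect \<sigma> u v w"
    have "Ob n \<tau> Us w = 0" if "length Us \<noteq> 1" for Us w
      using that by (auto simp: Ob_def split: list.splits)
    then show "Ob n \<tau> = leib_diff 1 (one_cochain \<sigma>)"
      by (rule degree_3_eqI) 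
        (simp_all only: * leib_diff_eq_0 leib_diff_1 one_cochain_Nil not_False_eq_True)
  qed (simp only: leib_diff_1 one_cochain_Nil, blast)
  have neg: "Vector_Spaces.linear scv scg (\<lambda>w. - \<sigma> w)"
    if "Vector_Spaces.linear scv scg \<sigma>" for \<sigma>
    by (rule linear_V_gI) (simp_all add: linear_rules[OF that])
  show ?thesis
    unfolding coboundaries_3_iff ext
  proof
    assume "\<exists>\<sigma>. Vector_Spaces.linear scv scg \<sigma> \<and> (\<forall>u v w. Ob n \<tau> [(u, v)] w = lin_defect \<sigma> u v w)"
    then obtain \<sigma> where "Vector_Spaces.linear scv scg \<sigma>"
      "\<forall>u v w. Ob n \<tau> [(u, v)] w = lin_defect \<sigma> u v w" by blast
    then show "\<exists>\<sigma>. Vector_Spaces.linear scv scg \<sigma> \<and>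
        (\<forall>u v w. Ob n \<tau> [(u, v)] w + lin_defect \<sigma> u v w = 0)"
      by (intro exI[of _ "\<lambda>w. - \<sigma> w"]) (simp add: neg lin_defect_uminus)
  next
    assume "\<exists>\<sigma>. Vector_Spaces.linear scv scg \<sigma> \<and>
        (\<forall>u v w. Ob n \<tau> [(u, v)] w + lin_defect \<sigma> u v w = 0)"
    then obtain \<sigma> where "Vector_Spaces.linear scv scg \<sigma>"
      "\<forall>u v w. Ob n \<tau> [(u, v)] w + lin_defect \<sigma> u v w = 0" by blast
    then show "\<exists>\<sigma>. Vector_Spaces.linear scv scg \<sigma> \<and>
        (\<forall>u v w. Ob n \<tau> [(u, v)] w = lin_defect \<sigma> u v w)"
      by (intro exI[of _ "\<lambda>w. - \<sigma> w"]) (simp add: neg lin_defect_uminus eq_neg_iff_add_eq_0)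
  qed
qed

theorem extendable_iff_obstruction_class_trivial:
  assumes "is_deformation n \<tau>"
  shows "extendable n \<tau> \<longleftrightarrow> obstruction_class n \<tau> = cohomology_class 3 0"
  unfolding obstruction_class_def cohomology_class_eq_0_iff Ob_coboundary_iff
  by (rule extendable_iff[OF assms])

end

theorem theorem5p10:
  fixes scg :: "'k::{alg_closed_field, field_char_0} \<Rightarrow> 'g::ab_group_add \<Rightarrow> 'g"
    and br :: "'g \<Rightarrow> 'g \<Rightarrow> 'g \<Rightarrow> 'g"
    and scv :: "'k \<Rightarrow> 'v::ab_group_add \<Rightarrow> 'v"
    and \<rho> :: "'g \<Rightarrow> 'g \<Rightarrow> 'v \<Rightarrow> 'v"
    and T :: "'v \<Rightarrow> 'g"
    and n :: nat
    and \<tau> :: "nat \<Rightarrow> 'v \<Rightarrow> 'g"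
  assumes "embedding_tensor scg br scv \<rho> T"
    and "embedding_tensor.is_deformation scg br scv \<rho> T n \<tau>"
  shows "embedding_tensor.extendable scg br scv \<rho> T n \<tau> \<longleftrightarrow>
    embedding_tensor.obstruction_class scg br scv \<rho> T n \<tau> =
    embedding_tensor.cohomology_class scg br scv \<rho> T 3 0"
  using assms by (rule embedding_tensor.extendable_iff_obstruction_class_trivial)

end
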